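(* Let $n,m\ge 0$ and let $q = Q_1x_1.\,Q_2x_2.\cdots Q_nx_n.\,\varphi(x_1,\dots,x_n)$ be a quantified boolean formula where each $Q_i\in\{\exists,\neg\exists\}$, the variables $x_1,\dots,x_n$ are distinct, and either $\varphi = C_1\land\dots\land C_m$ or $\varphi=\neg(C_1\land\dots\land C_m)$, each $C_j$ being a nonempty clause (disjunction of literals over $x_1,\dots,x_n$). Let $r'$ be the JavaScript regex and $s$ the string associated with $q$ (constructed in the context, $r'$ using positive lookaheads only and no negative lookaround). Then $r'$ matches $s$ starting from the beginning of $s$ if and only if $q$ is true.
   Context: **Regexes.** Fix an alphabet containing the characters $\mathtt{x}$, $\mathtt{;}$, $\mathtt{z}$. Regexes used here: the empty regex $\varepsilon$; a single character $c$; disjunction $r_1|r_2$; sequence $r_1r_2$; capture group $({}_g\, r)$ with group identifier $g$; backreference $\backslash g$; greedy star $r*$; positive lookahead $(?{=}\,r)$; end-of-string anchor $\$$. Brackets $\langle r\rangle$ are non-capturing and only used for parsing. Disjunction binds weaker than sequence. $\backslash g\,\mathtt{x}$ is the sequence of $\backslash g$ and $\mathtt{x}$. **JavaScript backtracking semantics (for these constructs).** Fix a string $s=s_0\cdots s_{|s|-1}$. A group map $\gamma$ assigns to each group identifier either "undefined", "opened at $a$", or a closed range $(a,b)$; $\emptyset$ is the everywhere undefined map. An action is a regex, $\mathrm{Aclose}\,g$, or $\mathrm{Acheck}\,k$ with $k$ a position. For a list of actions $l$, a position $0\le p\le |s|$ and a group map $\gamma$, the ordered list of results $L(l,p,\gamma)$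 is defined by: - $L([],p,\gamma)=[(p,\gamma)]$. - $L(\varepsilon::l,p,\gamma)=L(l,p,\gamma)$. - $L(c::l,p,\gamma)=L(l,p+1,\gamma)$ if $p<|s|$ and $s_p=c$, else $[]$. - $L((r_1|r_2)::l,p,\gamma)=L(r_1::l,p,\gamma)$ concatenated with $L(r_2::l,p,\gamma)$ (in this order). - $L(r_1r_2::l,p,\gamma)=L(r_1::r_2::l,p,\gamma)$. - $L(r*::l,p,\gamma)=L(r::\mathrm{Acheck}\,p::r*::l,p,\gamma')$ concatenated with $L(l,p,\gamma)$, where $\gamma'$ is $\gamma$ with all groups occurring in $r$ made undefined. - $L(\mathrm{Acheck}\,k::l,p,\gamma)=L(l,p,\gamma)$ if $p>k$, else $[]$. - $L(({}_g\,r)::l,p,\gamma)=L(r::\mathrm{Aclose}\,g::l,p,\gamma[g\mapsto\text{opened at }p])$. - $L(\mathrm{Aclose}\,g::l,p,\gamma)=L(l,p,\gamma[g\mapsto(a,p)])$ where $g$ is opened at $a$ in $\gamma$. - $L(\backslash g::l,p,\gamma)$: if $\gamma(g)$ is not a closed range, it is $L(l,p,\gamma)$ (the backreference matches the empty string); if $\gamma(g)=(a,b)$ and $w=s_a\cdots s_{b-1}$, it is $L(l,p+|w|,\gamma)$ if $w$ occurs in $s$ at position $p$, else $[]$. - $L((?{=}\,r)::l,p,\gamma)$: if $L([r],p,\gamma)=[]$ it is $[]$; otherwise, if $(p',\gamma')$ is the first element of $L([r],p,\gamma)$, it is $L(l,p,\gamma')$ (lookaheads are atomic: only the first result is used). -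 $L(\$::l,p,\gamma)=L(l,p,\gamma)$ if $p=|s|$, else $[]$. The regex $r'$ *matches $s$ from the beginning* if $L([r'],0,\emptyset)\ne[]$. **Truth of $q$.** Usual truth of quantified boolean formulas, where $\neg\exists x_i.\psi$ means $\neg(\exists x_i.\psi)$. **Construction.** Group identifiers are $1,\dots,n$ and further pairwise distinct identifiers $\mathtt{z}_1,\dots,\mathtt{z}_{n+1}$, distinct from $1,\dots,n$. Write $C_j=l_{j,1}\lor\dots\lor l_{j,v_j}$ with $v_j\ge1$. An empty concatenation of regexes is $\varepsilon$. - $R_{\mathrm{lit}}(x_i)=\backslash i$ and $R_{\mathrm{lit}}(\neg x_i)=\backslash i\,\mathtt{x}$. - $R_{\mathrm{cl}}(C_j)=\langle R_{\mathrm{lit}}(l_{j,1})|\cdots|R_{\mathrm{lit}}(l_{j,v_j})\rangle\,\mathtt{;}$ - $R_{\mathrm{conj}}=R_{\mathrm{cl}}(C_1)\cdots R_{\mathrm{cl}}(C_m)$. - $E(x_i)=\langle({}_i\,\mathtt{x})|\mathtt{x}\rangle\,\mathtt{;}$ - $R_{\mathrm{cap}}(g)=\langle\mathtt{x;}\rangle{*}\,({}_g\,\mathtt{z})$ and $R_{\mathrm{chk}}(g)=\langle\mathtt{x;}\rangle{*}\,\backslash g\,\$$. - $R'_{n+1}=R_{\mathrm{conj}}$ if $\varphi=C_1\land\dots\land C_m$, and $R'_{n+1}=(?{=}\,R_{\mathrm{conj}}\,|\,R_{\mathrm{cap}}(\mathtt{z}_{n+1}))\,R_{\mathrm{chk}}(\mathtt{z}_{n+1})$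 if $\varphi=\neg(C_1\land\dots\land C_m)$. - For $1\le i\le n$: $R'_i=E(x_i)R'_{i+1}$ if $Q_i=\exists$, and $R'_i=(?{=}\,E(x_i)R'_{i+1}\,|\,R_{\mathrm{cap}}(\mathtt{z}_i))\,R_{\mathrm{chk}}(\mathtt{z}_i)$ if $Q_i=\neg\exists$. - $r'=R'_1$, and $s$ is the string consisting of $n+m$ copies of $\mathtt{x;}$ followed by $\mathtt{z}$. *)

theory Defs
  imports Main
begin

section \<open>Regexes and their backtracking semantics\<close>

type_synonym gid = nat

datatype 'a regex =
    Eps
  | Chr 'a
  | Alt "'a regex" "'a regex"
  | Seq "'a regex" "'a regex"
  | Group gid "'a regex"
  | Backref gid
  | Star "'a regex"
  | Lookahead "'a regex"
  | EndAnchor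

datatype gval = Undef | Opened nat | Closed nat nat

type_synonym gmap = "gid \<Rightarrow> gval"

datatype 'a action = Areg "'a regex" | Aclose gid | Acheck nat

primrec groups :: "'a regex \<Rightarrow> gid set" where
  "groups Eps = {}"
| "groups (Chr c) = {}"
| "groups (Alt r1 r2) = groups r1 \<union> groups r2"
| "groups (Seq r1 r2) = groups r1 \<union> groups r2"
| "groups (Group g r) = insert g (groups r)"
| "groups (Backref g) = {}"
| "groups (Star r) = groups r"
| "groups (Lookahead r) = groups r"
| "groups EndAnchor = {}"

definition reset :: "gid set \<Rightarrow> gmap \<Rightarrow> gmap" where
  "reset G \<gamma> = (\<lambda>g. if g \<in> G then Undef else \<gamma> g)"

definition range_of :: "'a list \<Rightarrow> nat \<Rightarrow> nat \<Rightarrow> 'a list" where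
  "range_of s a b = take (b - a) (drop a s)"

definition occurs_at :: "'a list \<Rightarrow> 'a list \<Rightarrow> nat \<Rightarrow> bool" where
  "occurs_at w s p \<longleftrightarrow> take (length w) (drop p s) = w"

text \<open>
  \<open>L s l p \<gamma>\<close> is the ordered list of results on the string \<open>s\<close>. Closing a group that is not
  currently open has no meaning, hence the unspecified value \<open>undefined\<close> there.
\<close>

function (sequential) L ::
  "'a list \<Rightarrow> 'a action list \<Rightarrow> nat \<Rightarrow> gmap \<Rightarrow> (nat \<times> gmap) list" where
  "L s [] p \<gamma> = [(p, \<gamma>)]"
| "L s (Areg Eps # l) p \<gamma> = L s l p \<gamma>"
| "L s (Areg (Chr c) # l) p \<gamma> =
     (if p < length s \<and> s ! p = c then L s l (p + 1) \<gamma> else [])"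
| "L s (Areg (Alt r1 r2) # l) p \<gamma> = L s (Areg r1 # l) p \<gamma> @ L s (Areg r2 # l) p \<gamma>"
| "L s (Areg (Seq r1 r2) # l) p \<gamma> = L s (Areg r1 # Areg r2 # l) p \<gamma>"
| "L s (Areg (Star r) # l) p \<gamma> =
     L s (Areg r # Acheck p # Areg (Star r) # l) p (reset (groups r) \<gamma>) @ L s l p \<gamma>"
| "L s (Acheck k # l) p \<gamma> = (if p > k then L s l p \<gamma> else [])"
| "L s (Areg (Group g r) # l) p \<gamma> = L s (Areg r # Aclose g # l) p (\<gamma>(g := Opened p))"
| "L s (Aclose g # l) p \<gamma> =
     (case \<gamma> g of
        Opened a \<Rightarrow> L s l p (\<gamma>(g := Closed a p))
      | _ \<Rightarrow> undefined)"
| "L s (Areg (Backref g) # l) p \<gamma> =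
     (case \<gamma> g of
        Closed a b \<Rightarrow>
          (if occurs_at (range_of s a b) s p
           then L s l (p + length (range_of s a b)) \<gamma> else [])
      | _ \<Rightarrow> L s l p \<gamma>)"
| "L s (Areg (Lookahead r) # l) p \<gamma> =
     (case L s [Areg r] p \<gamma> of
        [] \<Rightarrow> []
      | (p', \<gamma>') # _ \<Rightarrow> L s l p \<gamma>')"
| "L s (Areg EndAnchor # l) p \<gamma> = (if p = length s then L s l p \<gamma> else [])"
  by pat_completeness auto

text \<open>
  Termination measure: a bound on the number of steps on a string of length \<open>n\<close> from
  position \<open>p\<close>. Passing \<open>Acheck k\<close> forces the position beyond \<open>k\<close>, so what follows it is
  measured from \<open>k + 1\<close>.
\<close>

fun rsteps :: "nat \<Rightarrow> nat \<Rightarrow> 'a regex \<Rightarrow> nat" where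
  "rsteps n p (Alt r1 r2) = 1 + rsteps n p r1 + rsteps n p r2"
| "rsteps n p (Seq r1 r2) = 1 + rsteps n p r1 + rsteps n p r2"
| "rsteps n p (Group g r) = 2 + rsteps n p r"
| "rsteps n p (Star r) = (n - p + 1) * (rsteps n p r + 2)"
| "rsteps n p (Lookahead r) = 1 + rsteps n p r"
| "rsteps n p _ = 1"

fun lsteps :: "nat \<Rightarrow> nat \<Rightarrow> 'a action list \<Rightarrow> nat" where
  "lsteps n p [] = 0"
| "lsteps n p (Areg r # l) = rsteps n p r + lsteps n p l"
| "lsteps n p (Aclose g # l) = 1 + lsteps n p l"
| "lsteps n p (Acheck k # l) =
     1 + (if k < p then lsteps n p l else if k < n then lsteps n (Suc k) l else 0)"

lemma rsteps_antimono: "p \<le> p' \<Longrightarrow> rsteps n p' r \<le> rsteps n p r"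
proof (induction r)
  case (Star r)
  then show ?case
    unfolding rsteps.simps by (intro mult_le_mono) auto
qed auto

lemma rsteps_pos: "0 < rsteps n p r"
  by (cases r) auto

lemma lsteps_antimono: "p \<le> p' \<Longrightarrow> p' \<le> n \<Longrightarrow> lsteps n p' l \<le> lsteps n p l"
proof (induction l arbitrary: p p')
  case Nil
  then show ?case by simp
next
  case (Cons a l)
  show ?case
  proof (cases a)
    case (Areg r)
    then show ?thesis
      using Cons rsteps_antimono[of p p' n r] by (auto intro: add_mono)
  next
    case (Aclose g)
    then show ?thesis using Cons by simp
  next
    case (Acheck k)
    then show ?thesis using Cons by auto
  qed
qed

lemma lsteps_star:
  "lsteps n p (Areg r # Acheck p # Areg (Star r) # l) < lsteps n p (Areg (Star r) # l)"
proof (cases "p < n")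
  case True
  have "rsteps n (Suc p) (Star r) \<le> (n - p) * (rsteps n p r + 2)"
    unfolding rsteps.simps using True rsteps_antimono[of p "Suc p" n r]
    by (intro mult_le_mono) auto
  moreover have "lsteps n (Suc p) l \<le> lsteps n p l"
    using True by (intro lsteps_antimono) auto
  moreover have "rsteps n p (Star r) = (n - p) * (rsteps n p r + 2) + (rsteps n p r + 2)"
    by simp
  ultimately show ?thesis
    using True by (simp del: rsteps.simps)
qed simp

lemma lsteps_backref:
  assumes "occurs_at w s p"
  shows "lsteps (length s) (p + length w) l \<le> lsteps (length s) p l"
proof (cases "w = []")
  case False
  have "min (length s - p) (length w) = length w"
    using arg_cong[OF assms[unfolded occurs_at_def], of length] by (simp add: min.commute)
  with False have "p + length w \<le> length s" by (cases w) auto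
  then show ?thesis by (intro lsteps_antimono) auto
qed simp

termination L
proof (relation "measure (\<lambda>(s, l, p, \<gamma>). lsteps (length s) p l)", goal_cases)
  case (3 s c l p \<gamma>)
  then show ?case
    using lsteps_antimono[of p "p + 1" "length s" l] by simp
next
  case (7 s r l p \<gamma>)
  show ?case
    using lsteps_star[of "length s" p r l] by (simp del: lsteps.simps rsteps.simps)
next
  case (14 s g l p \<gamma> a b)
  then show ?case
    using lsteps_backref[of "range_of s a b" s p l] by simp
qed (auto simp: rsteps_pos)

definition matches_from_start :: "'a regex \<Rightarrow> 'a list \<Rightarrow> bool" where
  "matches_from_start r s \<longleftrightarrow> L s [Areg r] 0 (\<lambda>_. Undef) \<noteq> []"


section \<open>Quantified boolean formulas\<close>

datatype quant = QEx | QNotEx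

datatype literal = Pos nat | Neg nat

type_synonym clause = "literal list"

datatype matrix = Conj (clauses: "clause list") | NotConj (clauses: "clause list")

primrec lit_var :: "literal \<Rightarrow> nat" where
  "lit_var (Pos i) = i"
| "lit_var (Neg i) = i"

primrec lit_true :: "(nat \<Rightarrow> bool) \<Rightarrow> literal \<Rightarrow> bool" where
  "lit_true \<sigma> (Pos i) = \<sigma> i"
| "lit_true \<sigma> (Neg i) = (\<not> \<sigma> i)"

definition clause_true :: "(nat \<Rightarrow> bool) \<Rightarrow> clause \<Rightarrow> bool" where
  "clause_true \<sigma> C \<longleftrightarrow> (\<exists>l\<in>set C. lit_true \<sigma> l)"

primrec matrix_true :: "(nat \<Rightarrow> bool) \<Rightarrow> matrix \<Rightarrow> bool" where
  "matrix_true \<sigma> (Conj Cs) = (\<forall>C\<in>set Cs. clause_true \<sigma> C)"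
| "matrix_true \<sigma> (NotConj Cs) = (\<not> (\<forall>C\<in>set Cs. clause_true \<sigma> C))"

text \<open>The head of the quantifier list binds the variable with index \<open>i\<close>, the next one \<open>i + 1\<close>, etc.\<close>

fun prefix_true :: "nat \<Rightarrow> quant list \<Rightarrow> matrix \<Rightarrow> (nat \<Rightarrow> bool) \<Rightarrow> bool" where
  "prefix_true i [] \<phi> \<sigma> = matrix_true \<sigma> \<phi>"
| "prefix_true i (QEx # Qs) \<phi> \<sigma> = (\<exists>b. prefix_true (i + 1) Qs \<phi> (\<sigma>(i := b)))"
| "prefix_true i (QNotEx # Qs) \<phi> \<sigma> = (\<not> (\<exists>b. prefix_true (i + 1) Qs \<phi> (\<sigma>(i := b))))"

text \<open>The initial assignment is irrelevant for formulas without free variables.\<close>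

definition qbf_true :: "quant list \<Rightarrow> matrix \<Rightarrow> bool" where
  "qbf_true Qs \<phi> \<longleftrightarrow> prefix_true 1 Qs \<phi> (\<lambda>_. False)"


section \<open>The regex and the string of a formula\<close>

text \<open>
  The characters x, semicolon and z are the parameters \<open>cx\<close>, \<open>cs\<close> and \<open>cz\<close>. The capture group of
  the \<open>i\<close>-th variable has identifier \<open>i\<close>; \<open>zid i\<close> is the \<open>i\<close>-th additional identifier.
\<close>

text \<open>Disjunctions are only formed of nonempty lists; \<open>alts []\<close> is unspecified.\<close>

fun alts :: "'a regex list \<Rightarrow> 'a regex" where
  "alts [r] = r"
| "alts (r # r' # rs) = Alt r (alts (r' # rs))"

fun seqs :: "'a regex list \<Rightarrow> 'a regex" where
  "seqs [] = Eps"
| "seqs [r] = r"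
| "seqs (r # r' # rs) = Seq r (seqs (r' # rs))"

primrec R_lit :: "'a \<Rightarrow> literal \<Rightarrow> 'a regex" where
  "R_lit cx (Pos i) = Backref i"
| "R_lit cx (Neg i) = Seq (Backref i) (Chr cx)"

definition R_cl :: "'a \<Rightarrow> 'a \<Rightarrow> clause \<Rightarrow> 'a regex" where
  "R_cl cx cs C = Seq (alts (map (R_lit cx) C)) (Chr cs)"

definition R_conj :: "'a \<Rightarrow> 'a \<Rightarrow> clause list \<Rightarrow> 'a regex" where
  "R_conj cx cs Cs = seqs (map (R_cl cx cs) Cs)"

definition R_ex :: "'a \<Rightarrow> 'a \<Rightarrow> nat \<Rightarrow> 'a regex" where
  "R_ex cx cs i = Seq (Alt (Group i (Chr cx)) (Chr cx)) (Chr cs)"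

definition R_cap :: "'a \<Rightarrow> 'a \<Rightarrow> 'a \<Rightarrow> gid \<Rightarrow> 'a regex" where
  "R_cap cx cs cz g = Seq (Star (Seq (Chr cx) (Chr cs))) (Group g (Chr cz))"

definition R_chk :: "'a \<Rightarrow> 'a \<Rightarrow> gid \<Rightarrow> 'a regex" where
  "R_chk cx cs g = Seq (Star (Seq (Chr cx) (Chr cs))) (Seq (Backref g) EndAnchor)"

definition R_not :: "'a \<Rightarrow> 'a \<Rightarrow> 'a \<Rightarrow> gid \<Rightarrow> 'a regex \<Rightarrow> 'a regex" where
  "R_not cx cs cz g r = Seq (Lookahead (Alt r (R_cap cx cs cz g))) (R_chk cx cs g)"

fun R_from :: "'a \<Rightarrow> 'a \<Rightarrow> 'a \<Rightarrow> (nat \<Rightarrow> gid) \<Rightarrow> nat \<Rightarrow> quant list \<Rightarrow> matrix \<Rightarrow> 'a regex" where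
  "R_from cx cs cz zid i [] (Conj Cs) = R_conj cx cs Cs"
| "R_from cx cs cz zid i [] (NotConj Cs) = R_not cx cs cz (zid i) (R_conj cx cs Cs)"
| "R_from cx cs cz zid i (QEx # Qs) \<phi> =
     Seq (R_ex cx cs i) (R_from cx cs cz zid (i + 1) Qs \<phi>)"
| "R_from cx cs cz zid i (QNotEx # Qs) \<phi> =
     R_not cx cs cz (zid i) (Seq (R_ex cx cs i) (R_from cx cs cz zid (i + 1) Qs \<phi>))"

definition qbf_regex :: "'a \<Rightarrow> 'a \<Rightarrow> 'a \<Rightarrow> (nat \<Rightarrow> gid) \<Rightarrow> quant list \<Rightarrow> matrix \<Rightarrow> 'a regex" where
  "qbf_regex cx cs cz zid Qs \<phi> = R_from cx cs cz zid 1 Qs \<phi>"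

definition qbf_string :: "'a \<Rightarrow> 'a \<Rightarrow> 'a \<Rightarrow> nat \<Rightarrow> nat \<Rightarrow> 'a list" where
  "qbf_string cx cs cz n m = concat (replicate (n + m) [cx, cs]) @ [cz]"

end

theory Submission
  imports Defs
begin

text \<open>
  An existential quantifier tries to capture the group of its variable before passing over it, so a
  true variable is a group holding x and a false one is undefined; a clause then consumes x followed
  by the semicolon iff one of its literals is true. In \<open>R_not\<close> the lookahead takes its second
  alternative, which captures z, exactly if the negated regex has no result. The subsequent check
  can reach the end of the string only if z was captured, since otherwise its backreference is empty
  and the letter z cannot be consumed. As the lookahead is atomic, it cannot be re-entered to capture
  z after the negated regex has matched. Because the results of a lookahead keep its captures, the
  induction over the quantifier prefix also has to show that a subregex only changes its own groups.
\<close>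

lemma occurs_at_singleton: "occurs_at [c] s p \<longleftrightarrow> p < length s \<and> s ! p = c"
  by (cases "p < length s") (auto simp: occurs_at_def take_Suc hd_drop_conv_nth)

lemma range_of_singleton: "p < length s \<Longrightarrow> range_of s p (Suc p) = [s ! p]"
  by (simp add: range_of_def take_Suc hd_drop_conv_nth)

lemma length_concat_replicate: "length (concat (replicate k w)) = k * length w"
  by (induction k) auto

lemma nth_concat_replicate_pair:
  "k < N \<Longrightarrow> concat (replicate N [a, b]) ! (2 * k) = a \<and>
    concat (replicate N [a, b]) ! Suc (2 * k) = b"
proof (induction N arbitrary: k)
  case (Suc N)
  then show ?case by (cases k) auto
qed simp

lemma L_alts:
  "rs \<noteq> [] \<Longrightarrow> L s (Areg (alts rs) # l) p \<gamma> = concat (map (\<lambda>r. L s (Areg r # l) p \<gamma>) rs)"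
  by (induction rs rule: alts.induct) auto

locale qbf_word =
  fixes cx cs cz :: 'a and N :: nat and s :: "'a list"
  assumes distinct_chars: "distinct [cx, cs, cz]"
    and length_s: "length s = Suc (2 * N)"
    and nth_x: "k < N \<Longrightarrow> s ! (2 * k) = cx"
    and nth_semi: "k < N \<Longrightarrow> s ! Suc (2 * k) = cs"
    and nth_z: "s ! (2 * N) = cz"
begin

declare L.simps(6) [simp del]

text \<open>Greediness lists the reachable block boundaries from the last one down. Each round
  advances by two letters, so \<open>Acheck\<close> passes, and the body has no groups to reset. The
  induction descends from \<open>N\<close>, where z stops the loop.\<close>

lemma L_star:
  assumes "k \<le> N"
  shows "L s (Areg (Star (Seq (Chr cx) (Chr cs))) # l) (2 * k) \<gamma> =
    concat (map (\<lambda>j. L s l (2 * j) \<gamma>) (rev [k..<Suc N]))"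
  using assms
proof (induction k rule: inc_induct)
  case base
  show ?case
    using distinct_chars by (subst L.simps(6)) (auto simp: nth_z)
next
  case (step k)
  have "reset {} \<gamma> = \<gamma>"
    by (simp add: reset_def)
  then show ?case
    using step
    by (subst L.simps(6)) (simp add: nth_x nth_semi length_s upt_conv_Cons del: upt_Suc)
qed

text \<open>The letter z stands only behind the last block, so every shorter run of the star fails
  at an x.\<close>

lemma L_R_cap:
  assumes "k \<le> N"
  shows "L s [Areg (R_cap cx cs cz g)] (2 * k) \<gamma> =
    [(Suc (2 * N), \<gamma>(g := Closed (2 * N) (Suc (2 * N))))]"
proof -
  have "L s [Areg (Group g (Chr cz))] (2 * j) \<gamma> = []" if "j < N" for j
    using that distinct_chars by (auto simp: nth_x)
  then have "concat (map (\<lambda>j. L s [Areg (Group g (Chr cz))] (2 * j) \<gamma>) (rev [k..<N])) = []"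
    by auto
  with assms show ?thesis
    by (simp add: R_cap_def L_star length_s nth_z)
qed

text \<open>The star stops at even positions and an undefined group matches the empty word, while
  the end of the string, \<open>Suc (2 * N)\<close>, is odd.\<close>

lemma L_R_chk_Undef:
  assumes "k \<le> N" "\<gamma> g = Undef"
  shows "L s [Areg (R_chk cx cs g)] (2 * k) \<gamma> = []"
  using assms by (auto simp: R_chk_def L_star length_s)

lemma L_R_chk_Closed:
  assumes "k \<le> N" "\<gamma> g = Closed (2 * N) (Suc (2 * N))"
  shows "L s [Areg (R_chk cx cs g)] (2 * k) \<gamma> = [(Suc (2 * N), \<gamma>)]"
proof -
  have "range_of s (2 * N) (Suc (2 * N)) = [cz]"
    by (simp add: range_of_singleton length_s nth_z)
  with assms(2) have "L s [Areg (Seq (Backref g) EndAnchor)] (2 * j) \<gamma> =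
    (if j = N then [(Suc (2 * N), \<gamma>)] else [])" if "j \<le> N" for j
    using that distinct_chars nth_x[of j]
    by (cases "j = N") (auto simp: length_s occurs_at_singleton nth_z)
  then have "concat (map (\<lambda>j. L s [Areg (Seq (Backref g) EndAnchor)] (2 * j) \<gamma>) (rev [k..<Suc N])) =
    concat (map (\<lambda>j. if j = N then [(Suc (2 * N), \<gamma>)] else []) (rev [k..<Suc N]))"
    by (intro arg_cong[where f = concat] map_cong) auto
  also have "\<dots> = [(Suc (2 * N), \<gamma>)]"
    using assms(1) by simp
  finally show ?thesis
    using assms(1) by (simp only: R_chk_def L.simps(5) L_star)
qed

text \<open>If \<open>r\<close> has a result, the atomic lookahead hands on the group map of the
  first one; by the second assumption \<open>g\<close> is still undefined there, so the check
  fails.\<close>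

lemma L_R_not:
  assumes "k \<le> N" "\<And>p' \<gamma>'. (p', \<gamma>') \<in> set (L s [Areg r] (2 * k) \<gamma>) \<Longrightarrow> \<gamma>' g = Undef"
  shows "L s [Areg (R_not cx cs cz g r)] (2 * k) \<gamma> =
    (if L s [Areg r] (2 * k) \<gamma> = []
     then [(Suc (2 * N), \<gamma>(g := Closed (2 * N) (Suc (2 * N))))] else [])"
proof (cases "L s [Areg r] (2 * k) \<gamma>")
  case Nil
  with assms(1) show ?thesis
    by (simp add: R_not_def L_R_cap L_R_chk_Closed)
next
  case (Cons a xs)
  moreover obtain p' \<gamma>' where "a = (p', \<gamma>')" by force
  ultimately show ?thesis
    using assms(1) assms(2)[of p' \<gamma>'] by (simp add: R_not_def L_R_chk_Undef)
qed

lemma L_R_ex: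
  assumes "k < N"
  shows "L s (Areg (R_ex cx cs i) # l) (2 * k) \<gamma> =
    L s l (2 * Suc k) (\<gamma>(i := Closed (2 * k) (Suc (2 * k)))) @ L s l (2 * Suc k) \<gamma>"
  using assms by (simp add: R_ex_def length_s nth_x nth_semi)

text \<open>The first \<open>k\<close> variables have been decided. A true one holds the x of its
  own block; false and undecided ones look alike, and \<open>\<sigma>\<close> is unconstrained
  beyond \<open>k\<close>. Variables are numbered from 1 but blocks from 0, hence
  \<open>Suc j\<close>.\<close>

definition encodes :: "nat \<Rightarrow> nat \<Rightarrow> (nat \<Rightarrow> bool) \<Rightarrow> gmap \<Rightarrow> bool" where
  "encodes n k \<sigma> \<gamma> \<longleftrightarrow> (\<forall>j<n. \<gamma> (Suc j) =
     (if j < k \<and> \<sigma> (Suc j) then Closed (2 * j) (Suc (2 * j)) else Undef))"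

lemma encodes_step:
  assumes "encodes n k \<sigma> \<gamma>"
  shows "encodes n (Suc k) (\<sigma>(Suc k := True)) (\<gamma>(Suc k := Closed (2 * k) (Suc (2 * k))))"
    and "encodes n (Suc k) (\<sigma>(Suc k := False)) \<gamma>"
  using assms by (auto simp: encodes_def less_Suc_eq)

text \<open>A block has a single x before its semicolon. The backreference to a true variable
  consumes it, that to a false one is empty and leaves it to the \<open>Chr cx\<close> of a negative
  literal.\<close>

lemma L_R_lit:
  assumes "encodes n n \<sigma> \<gamma>" "lit_var lt \<in> {1..n}" "n \<le> N" "k < N"
  shows "L s (Areg (R_lit cx lt) # Areg (Chr cs) # l) (2 * k) \<gamma> =
    (if lit_true \<sigma> lt then L s l (2 * Suc k) \<gamma> else [])"
proof -
  obtain j where j: "lit_var lt = Suc j" "j < n"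
    using assms(2) by (cases "lit_var lt") auto
  with assms(1) have "\<gamma> (Suc j) = (if \<sigma> (Suc j) then Closed (2 * j) (Suc (2 * j)) else Undef)"
    by (simp add: encodes_def)
  then show ?thesis
    using j assms(3,4) distinct_chars
    by (cases lt)
      (auto simp: range_of_singleton occurs_at_singleton length_s nth_x nth_semi)
qed

text \<open>Sets replace lists because each true literal contributes its own copy of the same
  results.\<close>

lemma L_R_cl:
  assumes "encodes n n \<sigma> \<gamma>" "C \<noteq> []" "\<forall>lt\<in>set C. lit_var lt \<in> {1..n}" "n \<le> N" "k < N"
  shows "set (L s (Areg (R_cl cx cs C) # l) (2 * k) \<gamma>) =
    (if clause_true \<sigma> C then set (L s l (2 * Suc k) \<gamma>) else {})"
  using assms by (auto simp: R_cl_def L_alts L_R_lit clause_true_def split: if_splits)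

lemma L_R_conj:
  assumes "encodes n n \<sigma> \<gamma>" "n \<le> N" "k + length Cs \<le> N"
    and "\<forall>C\<in>set Cs. C \<noteq> [] \<and> (\<forall>lt\<in>set C. lit_var lt \<in> {1..n})"
  shows "set (L s [Areg (R_conj cx cs Cs)] (2 * k) \<gamma>) =
    (if \<forall>C\<in>set Cs. clause_true \<sigma> C then {(2 * (k + length Cs), \<gamma>)} else {})"
  using assms(3,4)
proof (induction Cs arbitrary: k)
  case Nil
  then show ?case by (simp add: R_conj_def)
next
  case (Cons C Cs)
  have "set (L s [Areg (R_conj cx cs (C # Cs))] (2 * k) \<gamma>) =
    (if clause_true \<sigma> C then set (L s [Areg (R_conj cx cs Cs)] (2 * Suc k) \<gamma>) else {})"
    using Cons.prems L_R_cl[OF assms(1), of C k] assms(2)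
    \<comment> \<open>\<open>seqs\<close> adds no trailing \<open>Eps\<close> to a one-element list,
      so the last clause is a case of its own.\<close>
    by (cases Cs) (simp_all add: R_conj_def)
  also have "set (L s [Areg (R_conj cx cs Cs)] (2 * Suc k) \<gamma>) =
    (if \<forall>C\<in>set Cs. clause_true \<sigma> C then {(2 * (Suc k + length Cs), \<gamma>)} else {})"
    using Cons.prems by (intro Cons.IH) auto
  finally show ?case by simp
qed

text \<open>The second conjunct is a frame property, which yields the assumption of
  \<open>L_R_not\<close> one level further out in the prefix. Index \<open>n+1\<close> of
  \<open>zid\<close> belongs to a negated matrix.\<close>

lemma L_R_from:
  assumes "inj_on zid {1..n+1}" "zid ` {1..n+1} \<inter> {1..n} = {}"
    and \<phi>: "n + length (clauses \<phi>) \<le> N"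
      "\<forall>C\<in>set (clauses \<phi>). C \<noteq> [] \<and> (\<forall>lt\<in>set C. lit_var lt \<in> {1..n})"
    and "k + length Qs = n" "encodes n k \<sigma> \<gamma>" "\<forall>j\<in>{Suc k..n+1}. \<gamma> (zid j) = Undef"
  shows "(L s [Areg (R_from cx cs cz zid (Suc k) Qs \<phi>)] (2 * k) \<gamma> \<noteq> [] \<longleftrightarrow>
      prefix_true (Suc k) Qs \<phi> \<sigma>) \<and>
    (\<forall>(p', \<gamma>') \<in> set (L s [Areg (R_from cx cs cz zid (Suc k) Qs \<phi>)] (2 * k) \<gamma>).
      \<forall>g. g \<notin> {Suc k..n} \<union> zid ` {Suc k..n+1} \<longrightarrow> \<gamma>' g = \<gamma> g)"
  using assms(5-)
proof (induction Qs arbitrary: k \<sigma> \<gamma>)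
  case Nil
  have conj: "set (L s [Areg (R_conj cx cs (clauses \<phi>))] (2 * k) \<gamma>) =
    (if \<forall>C\<in>set (clauses \<phi>). clause_true \<sigma> C then {(2 * (k + length (clauses \<phi>)), \<gamma>)} else {})"
    using Nil \<phi> by (intro L_R_conj[where n = n]) auto
  show ?case
  proof (cases \<phi>)
    case (Conj Cs)
    with conj show ?thesis by (auto simp flip: set_empty)
  next
    case (NotConj Cs)
    have "k \<le> N" "\<gamma> (zid (Suc k)) = Undef" using Nil \<phi> by auto
    moreover from this conj NotConj have "\<gamma>' (zid (Suc k)) = Undef"
      if "(p', \<gamma>') \<in> set (L s [Areg (R_conj cx cs Cs)] (2 * k) \<gamma>)" for p' \<gamma>'
      using that by (auto split: if_splits)
    ultimately have "L s [Areg (R_not cx cs cz (zid (Suc k)) (R_conj cx cs Cs))] (2 * k) \<gamma> =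
      (if L s [Areg (R_conj cx cs Cs)] (2 * k) \<gamma> = []
       then [(Suc (2 * N), \<gamma>(zid (Suc k) := Closed (2 * N) (Suc (2 * N))))] else [])"
      by (intro L_R_not)
    with conj NotConj Nil show ?thesis
      by (auto simp del: L.simps simp flip: set_empty)
  qed
next
  case (Cons Q Qs)
  let ?R = "R_from cx cs cz zid (Suc (Suc k)) Qs \<phi>"
  let ?X = "L s [Areg (Seq (R_ex cx cs (Suc k)) ?R)] (2 * k) \<gamma>"
  \<comment> \<open>The identifier \<open>zid (Suc k)\<close> is left out: the body of a negated
    quantifier must not touch it. The variable \<open>Suc k\<close> is in, as the first branch
    captures it.\<close>
  let ?own = "{Suc k..n} \<union> zid ` {Suc (Suc k)..n+1}"
  have k: "k < n" "k < N" using Cons.prems(1) \<phi> by auto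
  have zid_var: "zid j \<notin> {1..n}" if "j \<in> {1..n+1}" for j
    using assms(2) that by blast
  define \<gamma>1 where "\<gamma>1 = \<gamma>(Suc k := Closed (2 * k) (Suc (2 * k)))"
  \<comment> \<open>The capturing branch makes variable \<open>Suc k\<close> true; the other makes
    it false and leaves the group map as it is.\<close>
  have X: "?X = L s [Areg ?R] (2 * Suc k) \<gamma>1 @ L s [Areg ?R] (2 * Suc k) \<gamma>"
    using k by (simp add: L_R_ex \<gamma>1_def)
  have len: "Suc k + length Qs = n"
    using Cons.prems(1) by simp
  have enc: "encodes n (Suc k) (\<sigma>(Suc k := True)) \<gamma>1"
    unfolding \<gamma>1_def by (rule encodes_step(1)[OF Cons.prems(2)])
  have "\<forall>j\<in>{Suc (Suc k)..n+1}. \<gamma>1 (zid j) = Undef"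
  proof
    fix j assume "j \<in> {Suc (Suc k)..n+1}"
    then show "\<gamma>1 (zid j) = Undef"
      using Cons.prems(3) zid_var[of j] k by (auto simp: \<gamma>1_def)
  qed
  note ih1 = Cons.IH[OF len enc this]
  have "\<forall>j\<in>{Suc (Suc k)..n+1}. \<gamma> (zid j) = Undef"
    using Cons.prems(3) by auto
  note ih2 = Cons.IH[OF len encodes_step(2)[OF Cons.prems(2)] this]
  have truth: "?X \<noteq> [] \<longleftrightarrow> (\<exists>b. prefix_true (Suc (Suc k)) Qs \<phi> (\<sigma>(Suc k := b)))"
    unfolding X ex_bool_eq using ih1[THEN conjunct1] ih2[THEN conjunct1]
    by (simp only: append_is_Nil_conv) blast
  have frame: "\<gamma>' g = \<gamma> g" if "(p', \<gamma>') \<in> set ?X" "g \<notin> ?own" for p' \<gamma>' g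
  proof -
    have g: "g \<notin> {Suc (Suc k)..n} \<union> zid ` {Suc (Suc k)..n+1}" "\<gamma>1 g = \<gamma> g"
      using that(2) k by (auto simp: \<gamma>1_def)
    from that(1) consider "(p', \<gamma>') \<in> set (L s [Areg ?R] (2 * Suc k) \<gamma>1)"
      | "(p', \<gamma>') \<in> set (L s [Areg ?R] (2 * Suc k) \<gamma>)"
      unfolding X by (auto simp only: set_append)
    then show ?thesis
    proof cases
      case 1
      from bspec[OF ih1[THEN conjunct2] this] g show ?thesis by simp
    next
      case 2
      from bspec[OF ih2[THEN conjunct2] this] g show ?thesis by simp
    qed
  qed
  show ?case
  proof (cases Q)
    case QEx
    have "\<gamma>' g = \<gamma> g" if "(p', \<gamma>') \<in> set ?X" "g \<notin> {Suc k..n} \<union> zid ` {Suc k..n+1}" for p' \<gamma>' g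
      using that by (intro frame) auto
    with truth QEx show ?thesis
      by (auto simp del: L.simps)
  next
    case QNotEx
    \<comment> \<open>Disjointness from the variables and injectivity put \<open>zid (Suc k)\<close>
      outside \<open>?own\<close>, so it stays undefined.\<close>
    have "zid (Suc k) \<notin> {Suc k..n}"
      using zid_var[of "Suc k"] k by auto
    moreover have "zid (Suc k) \<notin> zid ` {Suc (Suc k)..n+1}"
    proof
      assume "zid (Suc k) \<in> zid ` {Suc (Suc k)..n+1}"
      then obtain j where j: "j \<in> {Suc (Suc k)..n+1}" "zid (Suc k) = zid j"
        by blast
      then show False
        using inj_onD[OF assms(1), of "Suc k" j] k by auto
    qed
    ultimately have "\<gamma>' (zid (Suc k)) = Undef" if "(p', \<gamma>') \<in> set ?X" for p' \<gamma>'
      using frame[OF that, of "zid (Suc k)"] Cons.prems(3) k by auto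
    then have "L s [Areg (R_not cx cs cz (zid (Suc k)) (Seq (R_ex cx cs (Suc k)) ?R))] (2 * k) \<gamma> =
      (if ?X = [] then [(Suc (2 * N), \<gamma>(zid (Suc k) := Closed (2 * N) (Suc (2 * N))))] else [])"
      using k by (intro L_R_not) auto
    with truth QNotEx k show ?thesis
      by (auto simp del: L.simps)
  qed
qed

end

theorem theorem3:
  fixes cx cs cz :: 'a
    and zid :: "nat \<Rightarrow> gid"
    and n m :: nat
    and Qs :: "quant list"
    and \<phi> :: matrix
  assumes "distinct [cx, cs, cz]"
    and "length Qs = n"
    and "length (clauses \<phi>) = m"
    and "\<forall>C\<in>set (clauses \<phi>). C \<noteq> [] \<and> (\<forall>l\<in>set C. lit_var l \<in> {1..n})"
    and "inj_on zid {1..n+1}"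
    and "zid ` {1..n+1} \<inter> {1..n} = {}"
  shows "matches_from_start (qbf_regex cx cs cz zid Qs \<phi>) (qbf_string cx cs cz n m)
           \<longleftrightarrow> qbf_true Qs \<phi>"
proof -
  interpret qbf_word cx cs cz "n + m" "qbf_string cx cs cz n m"
    using assms(1) nth_concat_replicate_pair[of _ "n + m" cx cs]
    by unfold_locales (auto simp: qbf_string_def nth_append length_concat_replicate)
  \<comment> \<open>With no variable decided, the empty group map encodes every assignment, in
    particular the initial one of \<open>qbf_true\<close>.\<close>
  have "encodes n 0 (\<lambda>_. False) (\<lambda>_. Undef)"
    by (simp add: encodes_def)
  with L_R_from[OF assms(5,6), of \<phi> 0 Qs "\<lambda>_. False" "\<lambda>_. Undef"] assms(2-4)
  show ?thesis
    by (simp add: matches_from_start_def qbf_regex_def qbf_true_def)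
qed

end
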